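(* Let $Q\subset\mathbb{C}^n$ be a complete circular domain centered at $0\in Q$, let $p\in(0,2]$, and let $f$ be holomorphic in $Q$ with homogeneous expansion $f(z)=\sum_{k=0}^{\infty}P_k(z)$ converging in $Q$, such that $|f(z)|<1$ for all $z\in Q$. Put $a=|f(0)|<1$ and $$r_p(a)=\frac{1-a^p}{2-a^2-a^p}.$$ Then $$|f(0)|^p+\sum_{k=1}^{\infty}|P_k(z)|+\left(\frac{1}{1+a}+\frac{r}{1-r}\right)\sum_{k=1}^{\infty}|P_k(z)|^2\le 1 \qquad ( * )$$ for all $z\in r_p(a)Q$ and all $0\le r\le r_p(a)$. Moreover, if $Q$ is convex, then the number $r_p(a)$ and the factor $\frac{1}{1+a}$ in $( * )$ cannot be improved. That is, for each $a\in[0,1)$: (i) for every $\rho\in(r_p(a),1]$ there exist a holomorphic $f$ on $Q$ with $|f|<1$ on $Q$ and $|f(0)|=a$, a point $z\in\rho Q$, and $0\le r\le\rho$ with $r<1$, for which $( * )$ fails; (ii) for every $c>\frac{1}{1+a}$ there exist a holomorphic $f$ on $Q$ with $|f|<1$ on $Q$ and $|f(0)|=a$, a point $z\in r_p(a)Q$, and $0\le r\le r_p(a)$, for which the inequality obtained from $( * )$ by replacing $\frac1{1+a}$ with $c$ fails.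
   Context: A domain $Q\subset\mathbb{C}^n$ is a complete circular domain centered at $0\in Q$ if $\xi z=(\xi z_1,\ldots,\xi z_n)\in Q$ for every $z\in Q$ and every $\xi\in\mathbb{C}$ with $|\xi|\le 1$. Every holomorphic function $f$ on such a $Q$ has an expansion $f(z)=\sum_{k=0}^\infty P_k(z)$, $z\in Q$, where $P_k$ is a homogeneous polynomial of degree $k$ and $P_0=f(0)$. For $\rho>0$, the homothetic domain is $\rho Q=\{\rho z: z\in Q\}$.
   Formalization: The sharpness part is proved for convex Q other than C^n; for Q = C^n it is false, since by Liouville every f with |f|<1 is constant and ( * ) reduces to a^p ≤ 1. *)

theory Defs
  imports "HOL-Analysis.Analysis"
begin

definition complete_circular_domain :: "(complex ^ 'n) set \<Rightarrow> bool" where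
  "complete_circular_domain Q \<longleftrightarrow>
     open Q \<and> connected Q \<and> 0 \<in> Q \<and> (\<forall>z\<in>Q. \<forall>\<xi>. cmod \<xi> \<le> 1 \<longrightarrow> \<xi> *s z \<in> Q)"

text \<open>Holomorphy in several variables on an open set: the real Frechet derivative exists
  at every point and is complex-linear.\<close>

definition holomorphic_Cn_on :: "(complex ^ 'n \<Rightarrow> complex) \<Rightarrow> (complex ^ 'n) set \<Rightarrow> bool" where
  "holomorphic_Cn_on f Q \<longleftrightarrow>
     (\<forall>z\<in>Q. \<exists>D. (f has_derivative D) (at z) \<and> (\<forall>c v. D (c *s v) = c * D v))"

text \<open>The sum ranges over the finitely many multi-indices of total degree \<open>k\<close>;
  the zero polynomial is homogeneous of every degree.\<close>

definition homogeneous_polynomial :: "nat \<Rightarrow> (complex ^ 'n \<Rightarrow> complex) \<Rightarrow> bool" where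
  "homogeneous_polynomial k P \<longleftrightarrow>
     (\<exists>c :: ('n \<Rightarrow> nat) \<Rightarrow> complex. \<forall>z.
        P z = (\<Sum>\<alpha> | (\<Sum>i\<in>UNIV. \<alpha> i) = k. c \<alpha> * (\<Prod>i\<in>UNIV. (z $ i) ^ \<alpha> i)))"

definition homogeneous_expansion_on ::
  "(complex ^ 'n \<Rightarrow> complex) \<Rightarrow> (nat \<Rightarrow> complex ^ 'n \<Rightarrow> complex) \<Rightarrow> (complex ^ 'n) set \<Rightarrow> bool" where
  "homogeneous_expansion_on f P Q \<longleftrightarrow>
     (\<forall>k. homogeneous_polynomial k (P k)) \<and> (\<forall>z\<in>Q. (\<lambda>k. P k z) sums f z)"

definition homothetic :: "real \<Rightarrow> (complex ^ 'n) set \<Rightarrow> (complex ^ 'n) set" where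
  "homothetic \<rho> Q = (\<lambda>z. \<rho> *\<^sub>R z) ` Q"

definition bohr_radius :: "real \<Rightarrow> real \<Rightarrow> real" where
  "bohr_radius p a = (1 - a powr p) / (2 - a\<^sup>2 - a powr p)"

text \<open>Since \<open>suminf\<close> is only meaningful for convergent series, convergence of the two
  series in \<open>bohr_sum\<close> is recorded separately.\<close>

definition bohr_summable :: "(nat \<Rightarrow> complex ^ 'n \<Rightarrow> complex) \<Rightarrow> complex ^ 'n \<Rightarrow> bool" where
  "bohr_summable P z \<longleftrightarrow>
     summable (\<lambda>k. cmod (P (Suc k) z)) \<and> summable (\<lambda>k. (cmod (P (Suc k) z))\<^sup>2)"

definition bohr_sum ::
  "real \<Rightarrow> real \<Rightarrow> real \<Rightarrow> (complex ^ 'n \<Rightarrow> complex) \<Rightarrow> (nat \<Rightarrow> complex ^ 'n \<Rightarrow> complex)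
     \<Rightarrow> complex ^ 'n \<Rightarrow> real" where
  "bohr_sum p c r f P z =
     cmod (f 0) powr p + (\<Sum>k. cmod (P (Suc k) z))
       + (c + r / (1 - r)) * (\<Sum>k. (cmod (P (Suc k) z))\<^sup>2)"

end

theory Submission
  imports Defs "HOL-Computational_Algebra.Polynomial"
begin

text \<open>The inequality is a statement about one complex variable. On the disc \<open>{\<xi> w. |\<xi>| \<le> 1}\<close> through
  a point \<open>w\<close> of the domain, \<open>f\<close> is a power series bounded by 1 whose coefficients \<open>a\<^sub>k = P\<^sub>k w\<close> satisfy
  Carlson's inequalities

  \<^item> \<open>|a\<^bsub>2n+1\<^esub>| \<le> 1 - |a\<^sub>0|\<^sup>2 - \<dots> - |a\<^sub>n|\<^sup>2\<close>,

  \<^item> \<open>|a\<^bsub>2n\<^esub>| \<le> 1 - |a\<^sub>0|\<^sup>2 - \<dots> - |a\<^bsub>n-1\<^esub>|\<^sup>2 - |a\<^sub>n|\<^sup>2 / (1 + |a\<^sub>0|)\<close> for \<open>n \<ge> 1\<close>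

  (\<open>carlson_odd\<close>, \<open>carlson_even\<close>). Multiplying them by \<open>t\<^sup>k\<close> and adding up gives exactly

  \<open>\<Sum>\<^sub>k\<^sub>\<ge>\<^sub>1 |a\<^sub>k| t\<^sup>k + (1 / (1 + |a\<^sub>0|) + t / (1 - t)) \<Sum>\<^sub>k\<^sub>\<ge>\<^sub>1 |a\<^sub>k|\<^sup>2 t\<^sup>2\<^sup>k \<le> (1 - |a\<^sub>0|\<^sup>2) t / (1 - t)\<close>

  (\<open>bohr_inequality_disc\<close>), and with \<open>a = |a\<^sub>0|\<close> the right-hand side is at most \<open>1 - a\<^sup>p\<close> precisely
  when \<open>t\<close> is at most the Bohr radius (\<open>bohr_radius_iff\<close>).

  Carlson's inequalities follow from multiplication by a function bounded by 1 being a contraction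
  on square-summable coefficient sequences (\<open>bounded_multiplier_l2_contraction\<close>), tested on one
  explicit polynomial built from the reflected coefficients (\<open>reflected_test_vector\<close>).

  For sharpness, convexity yields a complex-linear functional \<open>L\<close> with supremum 1 on \<open>Q\<close>
  (\<open>extremal_linear_functional\<close>). The function \<open>(a - L) / (1 - a L)\<close> turns the displayed inequality
  into an equality at all points where \<open>L = t\<close> (\<open>bohr_sum_extremal\<close>), and such points lie in \<open>\<rho> Q\<close>
  for every \<open>t < \<rho>\<close>. Hence any larger radius or any larger constant is refuted by this function at a
  suitable \<open>t\<close>.\<close>

section \<open>Parseval's formula at roots of unity\<close>

text \<open>Averaging \<open>|q|\<^sup>2\<close> over the \<open>M\<close>-th roots of unity kills all mixed terms, because for distinct
  exponents \<open>j, k < M\<close> the numbers \<open>\<omega>\<^sub>m\<^sup>j cnj \<omega>\<^sub>m\<^sup>k\<close> run through a nontrivial geometric progression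
  whose ratio is an \<open>M\<close>-th root of unity. For polynomials this does the work of Parseval's
  formula on the circle without any integration.\<close>

lemma discrete_parseval:
  fixes c :: "nat \<Rightarrow> complex"
  assumes M: "M > 0"
  shows "(\<Sum>m<M. (cmod (\<Sum>k<M. c k * cis (2 * pi * real m / real M) ^ k))\<^sup>2)
           = real M * (\<Sum>k<M. (cmod (c k))\<^sup>2)"
proof -
  define w where "w m = cis (2 * pi * real m / real M)" for m
  have inj: "inj_on w {..<M}"
    using Complex.bij_betw_roots_unity[OF M] unfolding w_def bij_betw_def by simp
  have w_swap: "w m ^ k = w k ^ m" for m k
    unfolding w_def Complex.DeMoivre by (rule arg_cong[of _ _ cis]) simp
  have w_cnj: "w k * cnj (w k) = 1" for k
    by (simp add: w_def complex_norm_square[symmetric] cis_cnj cis_mult)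
  have w_root: "w k ^ M = 1" for k
    using M by (simp add: w_def Complex.DeMoivre)
  have orth: "(\<Sum>m<M. (w j * cnj (w k)) ^ m) = (if j = k then of_nat M else 0)"
    if "j < M" "k < M" for j k
  proof (cases "j = k")
    case False
    have "w j * cnj (w k) \<noteq> 1"
    proof
      assume "w j * cnj (w k) = 1"
      then have "w j * (w k * cnj (w k)) = w k" by (simp add: algebra_simps)
      then have "w j = w k" by (simp add: w_cnj)
      with inj that False show False by (auto dest: inj_onD)
    qed
    moreover have "(w j * cnj (w k)) ^ M = 1"
      by (simp add: power_mult_distrib w_root flip: complex_cnj_power)
    ultimately show ?thesis using False by (simp add: sum_gp_strict)
  qed (simp add: w_cnj)
  have "complex_of_real (\<Sum>m<M. (cmod (\<Sum>k<M. c k * w m ^ k))\<^sup>2)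
      = (\<Sum>m<M. (\<Sum>j<M. c j * w m ^ j) * cnj (\<Sum>k<M. c k * w m ^ k))"
    by (simp only: of_real_sum complex_norm_square)
  also have "\<dots> = (\<Sum>m<M. \<Sum>j<M. \<Sum>k<M. c j * cnj (c k) * (w j * cnj (w k)) ^ m)"
    by (simp add: sum_product power_mult_distrib w_swap mult_ac flip: complex_cnj_power)
  also have "\<dots> = (\<Sum>j<M. \<Sum>m<M. \<Sum>k<M. c j * cnj (c k) * (w j * cnj (w k)) ^ m)"
    by (rule sum.swap)
  also have "\<dots> = (\<Sum>j<M. \<Sum>k<M. \<Sum>m<M. c j * cnj (c k) * (w j * cnj (w k)) ^ m)"
    by (rule sum.cong[OF refl], rule sum.swap)
  also have "\<dots> = (\<Sum>j<M. \<Sum>k<M. if j = k then of_nat M * (c j * cnj (c k)) else 0)"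
    by (intro sum.cong refl) (auto simp: orth simp flip: sum_distrib_left)
  also have "\<dots> = complex_of_real (real M * (\<Sum>k<M. (cmod (c k))\<^sup>2))"
    by (simp add: complex_norm_square sum_distrib_left flip: of_real_power)
  finally show ?thesis unfolding w_def of_real_eq_iff .
qed

lemma polynomial_parseval:
  fixes q :: "complex poly"
  assumes M: "degree q < M"
  shows "(\<Sum>m<M. (cmod (poly q (cis (2 * pi * real m / real M))))\<^sup>2)
           = real M * (\<Sum>k<M. (cmod (coeff q k))\<^sup>2)"
proof -
  have "poly q z = (\<Sum>k<M. coeff q k * z ^ k)" for z
    unfolding poly_altdef using M
    by (intro sum.mono_neutral_left) (auto simp: coeff_eq_0)
  then show ?thesis using discrete_parseval[of M "coeff q"] M by simp
qed

section \<open>Coefficient inequalities for bounded power series\<close>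

text \<open>The sum on the left is the squared norm of the first \<open>d + 1\<close> Taylor coefficients of \<open>g u\<close>, where
  \<open>g = \<Sum>a\<^sub>k z\<^sup>k\<close> and \<open>u\<close> is the polynomial with coefficients \<open>u\<^sub>j\<close>: the lower triangular Toeplitz
  matrix of a function bounded by 1 is a contraction. A partial sum of \<open>g\<close> of length \<open>N > d\<close>
  produces the same coefficients and is bounded on the unit circle by 1 plus a tail of the
  series \<open>\<Sum>|a\<^sub>k|\<close>, so the polynomial Parseval formula gives the claim up to that tail, and
  \<open>N\<close> tends to infinity.\<close>

lemma bounded_multiplier_l2_contraction:
  fixes a u :: "nat \<Rightarrow> complex"
  assumes summ: "summable (\<lambda>k. cmod (a k))"
    and bound: "\<And>z. cmod z = 1 \<Longrightarrow> cmod (\<Sum>k. a k * z ^ k) \<le> 1"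
  shows "(\<Sum>k\<le>d. (cmod (\<Sum>i\<le>k. a i * u (k - i)))\<^sup>2) \<le> (\<Sum>j\<le>d. (cmod (u j))\<^sup>2)"
    (is "?L \<le> ?R")
proof -
  define tail where "tail N = (\<Sum>k. cmod (a k)) - (\<Sum>k<N. cmod (a k))" for N
  define A where "A N = (\<Sum>k<N. monom (a k) k)" for N
  define U where "U = (\<Sum>j\<le>d. monom (u j) j)"
  have cA: "coeff (A N) k = (if k < N then a k else 0)" for N k
    by (simp add: A_def coeff_sum)
  have cU: "coeff U k = (if k \<le> d then u k else 0)" for k
    by (simp add: U_def coeff_sum)
  have degU: "degree U \<le> d" by (rule degree_le) (simp add: cU)
  have A_le: "cmod (poly (A N) z) \<le> 1 + tail N" if z: "cmod z = 1" for N z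
  proof -
    have s: "summable (\<lambda>k. cmod (a k * z ^ k))"
      using summ z by (simp add: norm_mult norm_power)
    have "(\<Sum>k. a k * z ^ k) = (\<Sum>k. a (k + N) * z ^ (k + N)) + poly (A N) z"
      using suminf_split_initial_segment[OF summable_norm_cancel[OF s], of N]
      by (simp add: A_def poly_sum poly_monom)
    then have "cmod (poly (A N) z) \<le> cmod (\<Sum>k. a k * z ^ k) + cmod (\<Sum>k. a (k + N) * z ^ (k + N))"
      by (metis add_diff_cancel_left' norm_triangle_ineq4)
    also have "cmod (\<Sum>k. a (k + N) * z ^ (k + N)) \<le> (\<Sum>k. cmod (a (k + N) * z ^ (k + N)))"
      using s by (intro summable_norm) (subst summable_iff_shift[of "\<lambda>k. cmod (a k * z ^ k)"])
    also have "\<dots> = tail N"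
      using suminf_split_initial_segment[OF summ, of N] z
      by (simp add: tail_def norm_mult norm_power)
    finally show ?thesis using bound[OF z] by linarith
  qed
  have "?L \<le> (1 + tail N)\<^sup>2 * ?R" if N: "d < N" for N
  proof -
    define M where "M = N + d + 1"
    have degA: "degree (A N) \<le> N" by (rule degree_le) (simp add: cA)
    have degM: "degree (A N * U) < M" "degree U < M"
      using degree_mult_le[of "A N" U] degA degU by (auto simp: M_def)
    have M0: "real M > 0" by (simp add: M_def)
    let ?w = "\<lambda>m. cis (2 * pi * real m / real M)"
    have "?L = (\<Sum>k\<le>d. (cmod (coeff (A N * U) k))\<^sup>2)"
      using N by (intro sum.cong refl arg_cong[of _ _ "\<lambda>x. (cmod x)\<^sup>2"])
        (auto simp: coeff_mult cA cU intro!: sum.cong)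
    also have "\<dots> \<le> (\<Sum>k<M. (cmod (coeff (A N * U) k))\<^sup>2)"
      by (intro sum_mono2) (auto simp: M_def)
    finally have "real M * ?L \<le> (\<Sum>m<M. (cmod (poly (A N * U) (?w m)))\<^sup>2)"
      using M0 by (subst polynomial_parseval[OF degM(1)]) (simp del: poly_mult)
    also have "\<dots> \<le> (\<Sum>m<M. (1 + tail N)\<^sup>2 * (cmod (poly U (?w m)))\<^sup>2)"
      using A_le by (intro sum_mono) (auto simp: norm_mult power_mult_distrib
        intro!: mult_right_mono power_mono)
    also have "\<dots> = real M * ((1 + tail N)\<^sup>2 * (\<Sum>k<M. (cmod (coeff U k))\<^sup>2))"
      by (simp add: polynomial_parseval[OF degM(2)] flip: sum_distrib_left)
    also have "(\<Sum>k<M. (cmod (coeff U k))\<^sup>2) = ?R"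
      by (rule sum.mono_neutral_cong_right) (auto simp: cU M_def)
    finally show ?thesis using M0 by simp
  qed
  then have ev: "eventually (\<lambda>N. ?L \<le> (1 + tail N)\<^sup>2 * ?R) sequentially"
    unfolding eventually_sequentially by (meson Suc_le_eq)
  have "tail \<longlonglongrightarrow> (\<Sum>k. cmod (a k)) - (\<Sum>k. cmod (a k))"
    unfolding tail_def by (intro tendsto_intros summable_LIMSEQ summ)
  then have "(\<lambda>N. (1 + tail N)\<^sup>2 * ?R) \<longlonglongrightarrow> (1 + 0)\<^sup>2 * ?R"
    by (intro tendsto_intros) simp
  from tendsto_lowerbound[OF this ev] show ?thesis by simp
qed

text \<open>The contraction property is tested on \<open>u = 1 + \<beta> z\<^sup>q + c \<Sum>\<^sub>i\<^sub><\<^sub>q cnj a\<^sub>i z\<^sup>d\<^sup>-\<^sup>i\<close>. The constant term puts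
  \<open>a\<^sub>0, \<dots>, a\<^bsub>q-1\<^esub>\<close> into the rows below \<open>q\<close>; the reflected block is aligned with the same numbers
  in row \<open>d\<close> and contributes \<open>c \<sigma>\<close> there. The condition \<open>2 q \<le> d + 1\<close> keeps the block away from the
  rows below \<open>q\<close>. For \<open>2 q \<le> d\<close> the position \<open>q\<close> is free as well and can carry \<open>\<beta>\<close>; for
  \<open>2 q = d + 1\<close> it belongs to the block, whence \<open>\<beta> = 0\<close> then.\<close>

lemma reflected_test_vector:
  fixes a :: "nat \<Rightarrow> complex" and \<beta> c :: complex
  assumes summ: "summable (\<lambda>k. cmod (a k))"
    and bound: "\<And>z. cmod z = 1 \<Longrightarrow> cmod (\<Sum>k. a k * z ^ k) \<le> 1"
    and q: "1 \<le> q" "2 * q \<le> d + 1" and \<beta>: "2 * q \<le> d \<or> \<beta> = 0"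
  defines "\<sigma> \<equiv> (\<Sum>k<q. (cmod (a k))\<^sup>2)"
  shows "\<sigma> + (if 2 * q \<le> d then (cmod (a q + \<beta> * a 0))\<^sup>2 else 0)
           + (cmod (a d + \<beta> * a (d - q) + c * of_real \<sigma>))\<^sup>2
         \<le> 1 + (cmod \<beta>)\<^sup>2 + (cmod c)\<^sup>2 * \<sigma>"
proof -
  \<comment> \<open>the reflected block: positions \<open>d - i\<close> for \<open>i < q\<close>, conjugated\<close>
  define v where "v j = (if d - q < j \<and> j \<le> d then cnj (a (d - j)) else 0)" for j
  define u where "u j = (if j = 0 then 1 else 0) + (if j = q then \<beta> else 0) + c * v j" for j
  define h where "h k = (\<Sum>i\<le>k. a i * u (k - i))" for k
  have h: "h k = a k + (if q \<le> k then \<beta> * a (k - q) else 0) + c * (\<Sum>i\<le>k. a i * v (k - i))" for k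
  proof -
    have "(\<Sum>i\<le>k. a i * (if k - i = 0 then 1 else 0)) = (\<Sum>i\<le>k. if i = k then a i else 0)"
      by (intro sum.cong) auto
    moreover have "(\<Sum>i\<le>k. a i * (if k - i = q then \<beta> else 0))
        = (\<Sum>i\<le>k. if i = k - q \<and> q \<le> k then \<beta> * a i else 0)"
      using q by (intro sum.cong) auto
    moreover have "\<dots> = (if q \<le> k then \<beta> * a (k - q) else 0)"
      by (cases "q \<le> k") auto
    ultimately show ?thesis
      by (simp add: h_def u_def distrib_left sum.distrib sum_distrib_left mult_ac)
  qed
  have vlow: "(\<Sum>i\<le>k. a i * v (k - i)) = 0" if "k \<le> d - q" for k
    using that by (intro sum.neutral) (auto simp: v_def)
  have hlow: "h k = a k" if "k < q" for k
    using that q by (simp add: h vlow)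
  have hmid: "h q = a q + \<beta> * a 0" if "2 * q \<le> d"
    using that q by (simp add: h vlow)
  have "(\<Sum>i\<le>d. a i * v (d - i)) = (\<Sum>i<q. a i * cnj (a i))"
    using q by (intro sum.mono_neutral_cong_right) (auto simp: v_def)
  then have hd: "h d = a d + \<beta> * a (d - q) + c * of_real \<sigma>"
    using q by (simp add: h \<sigma>_def complex_norm_square del: of_real_power)
  \<comment> \<open>besides the rows below \<open>q\<close>, only row \<open>d\<close> is kept, and row \<open>q\<close> if the block starts above it\<close>
  have "\<sigma> + (if 2 * q \<le> d then (cmod (h q))\<^sup>2 else 0) + (cmod (h d))\<^sup>2
      \<le> (\<Sum>k\<le>d. (cmod (h k))\<^sup>2)"
  proof -
    define S where "S = {..<q} \<union> (if 2 * q \<le> d then {q} else {}) \<union> {d}"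
    have "(\<Sum>k\<in>S. (cmod (h k))\<^sup>2) \<le> (\<Sum>k\<le>d. (cmod (h k))\<^sup>2)"
      using q by (intro sum_mono2) (auto simp: S_def)
    moreover have "(\<Sum>k<q. (cmod (h k))\<^sup>2) = \<sigma>"
      by (simp add: \<sigma>_def hlow)
    ultimately show ?thesis
      using q by (auto simp: S_def sum.union_disjoint split: if_splits)
  qed
  also have "\<dots> \<le> (\<Sum>j\<le>d. (cmod (u j))\<^sup>2)"
    unfolding h_def by (rule bounded_multiplier_l2_contraction[OF summ bound])
  also have "\<dots> = (\<Sum>j\<le>d. (if j = 0 then 1 else 0) + (if j = q then (cmod \<beta>)\<^sup>2 else 0)
                    + (cmod c)\<^sup>2 * (cmod (v j))\<^sup>2)"
  proof (intro sum.cong refl)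
    fix j
    show "(cmod (u j))\<^sup>2 = (if j = 0 then 1 else 0) + (if j = q then (cmod \<beta>)\<^sup>2 else 0)
                    + (cmod c)\<^sup>2 * (cmod (v j))\<^sup>2"
      using q \<beta> by (auto simp: u_def v_def norm_mult power_mult_distrib)
  qed
  also have "\<dots> = 1 + (cmod \<beta>)\<^sup>2 + (cmod c)\<^sup>2 * (\<Sum>j\<le>d. (cmod (v j))\<^sup>2)"
    using q by (simp add: sum.distrib sum_distrib_left)
  also have "(\<Sum>j\<le>d. (cmod (v j))\<^sup>2) = (\<Sum>j\<in>{d-q<..d}. (cmod (a (d - j)))\<^sup>2)"
    by (rule sum.mono_neutral_cong_right) (auto simp: v_def)
  also have "\<dots> = \<sigma>"
    unfolding \<sigma>_def using q
    by (intro sum.reindex_bij_witness[where i = "\<lambda>k. d - k" and j = "\<lambda>j. d - j"]) auto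
  finally show ?thesis using hd hmid by (simp split: if_splits)
qed

text \<open>The free parameter \<open>c\<close> of the test vector is optimised. When \<open>\<beta>\<close> costs no more than row \<open>q\<close> gives
  back, the inequality \<open>\<sigma> + |X + c \<sigma>|\<^sup>2 \<le> 1 + |c|\<^sup>2 \<sigma>\<close> holds for every \<open>c\<close>, and its discriminant
  bounds \<open>|X|\<close> linearly in \<open>1 - \<sigma>\<close>; taking \<open>c = 0\<close> alone would only bound \<open>|X|\<^sup>2\<close>.\<close>

lemma leading_coefficient_bound:
  fixes a :: "nat \<Rightarrow> complex" and \<beta> :: complex
  assumes summ: "summable (\<lambda>k. cmod (a k))"
    and bound: "\<And>z. cmod z = 1 \<Longrightarrow> cmod (\<Sum>k. a k * z ^ k) \<le> 1"
    and q: "1 \<le> q" "2 * q \<le> d + 1" and \<beta>: "\<beta> = 0 \<or> (2 * q \<le> d \<and> cmod \<beta> \<le> cmod (a q + \<beta> * a 0))"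
  shows "cmod (a d + \<beta> * a (d - q)) \<le> 1 - (\<Sum>k<q. (cmod (a k))\<^sup>2)"
proof -
  define \<sigma> where "\<sigma> = (\<Sum>k<q. (cmod (a k))\<^sup>2)"
  define X where "X = a d + \<beta> * a (d - q)"
  have \<sigma>0: "\<sigma> \<ge> 0" unfolding \<sigma>_def by (intro sum_nonneg) auto
  have ineq: "\<sigma> + (cmod (X + c * of_real \<sigma>))\<^sup>2 \<le> 1 + (cmod c)\<^sup>2 * \<sigma>" for c
  proof -
    have b: "2 * q \<le> d \<or> \<beta> = 0" using \<beta> by auto
    have "(cmod \<beta>)\<^sup>2 \<le> (if 2 * q \<le> d then (cmod (a q + \<beta> * a 0))\<^sup>2 else 0)"
      using \<beta> by (auto intro: power_mono)
    then show ?thesis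
      using reflected_test_vector[OF summ bound q b, of c] unfolding \<sigma>_def X_def by linarith
  qed
  have \<sigma>1: "\<sigma> \<le> 1" using order_trans[OF _ ineq[of 0], of \<sigma>] by simp
  show ?thesis
  proof (cases "X = 0 \<or> \<sigma> = 1")
    case True
    then show ?thesis using ineq[of 0] \<sigma>1 unfolding X_def[symmetric] \<sigma>_def[symmetric] by auto
  next
    case False
    define s where "s = 1 - \<sigma>"
    have s: "s > 0" using False \<sigma>1 by (simp add: s_def)
    \<comment> \<open>the maximiser of \<open>|X + c \<sigma>|\<^sup>2 - |c|\<^sup>2 \<sigma>\<close>\<close>
    define c where "c = of_real (1 / s) * X"
    have cc: "cmod c = cmod X / s" using s by (simp add: c_def norm_divide)
    have "X + c * of_real \<sigma> = of_real (1 / s) * X"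
      using s by (simp add: c_def s_def field_simps)
    then have "\<sigma> + (cmod X / s)\<^sup>2 \<le> 1 + (cmod X / s)\<^sup>2 * \<sigma>"
      using ineq[of c] s unfolding cc by (simp add: norm_divide)
    then have "(cmod X / s)\<^sup>2 * s \<le> s" by (simp add: s_def algebra_simps)
    then have "(cmod X / s)\<^sup>2 \<le> 1" using s by simp
    then have "cmod X / s \<le> 1" using s by (simp add: abs_square_le_1 divide_le_eq)
    then show ?thesis using s unfolding X_def[symmetric] \<sigma>_def[symmetric] s_def by simp
  qed
qed

text \<open>Carlson's coefficient inequalities for functions bounded by 1. In the odd case \<open>\<beta> = 0\<close>
  and the reflected block starts right above the rows \<open>0, \<dots>, n\<close>.\<close>

lemma carlson_odd:
  fixes a :: "nat \<Rightarrow> complex"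
  assumes "summable (\<lambda>k. cmod (a k))"
    and "\<And>z. cmod z = 1 \<Longrightarrow> cmod (\<Sum>k. a k * z ^ k) \<le> 1"
  shows "cmod (a (2 * n + 1)) \<le> 1 - (\<Sum>k\<le>n. (cmod (a k))\<^sup>2)"
  using leading_coefficient_bound[OF assms, of "Suc n" "2 * n + 1" 0] by (simp add: lessThan_Suc_atMost)

text \<open>Here the middle position \<open>n\<close> is left for \<open>\<beta>\<close>. With \<open>|\<beta>| = |a\<^sub>n| / (1 + |a\<^sub>0|)\<close> row \<open>n\<close> has modulus
  at least \<open>|a\<^sub>n| - |\<beta>| |a\<^sub>0| = |\<beta>|\<close>, so \<open>\<beta>\<close> pays for itself whatever its argument; the argument is
  chosen such that \<open>\<beta> a\<^sub>n\<close> points in the direction of \<open>a\<^bsub>2n\<^esub>\<close>.\<close>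

lemma carlson_even:
  fixes a :: "nat \<Rightarrow> complex"
  assumes "summable (\<lambda>k. cmod (a k))"
    and "\<And>z. cmod z = 1 \<Longrightarrow> cmod (\<Sum>k. a k * z ^ k) \<le> 1"
    and n: "1 \<le> n"
  shows "cmod (a (2 * n)) \<le> 1 - (\<Sum>k<n. (cmod (a k))\<^sup>2) - (cmod (a n))\<^sup>2 / (1 + cmod (a 0))"
proof -
  define t where "t = cmod (a n) / (1 + cmod (a 0))"
  have t0: "t \<ge> 0" by (simp add: t_def)
  have den: "1 + cmod (a 0) > 0" by (simp add: add_pos_nonneg)
  obtain \<theta> where \<theta>: "cmod \<theta> = 1"
      "cmod (a (2 * n) + \<theta> * (of_real t * a n)) = cmod (a (2 * n)) + t * cmod (a n)"
  proof -
    define \<theta> where "\<theta> = cis (Arg (a (2 * n)) - Arg (of_real t * a n))"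
    have "a (2 * n) = of_real (cmod (a (2 * n))) * cis (Arg (a (2 * n)))"
      by (metis rcis_cmod_Arg rcis_def)
    moreover have "of_real t * a n = of_real (cmod (of_real t * a n)) * cis (Arg (of_real t * a n))"
      by (metis rcis_cmod_Arg rcis_def)
    then have "\<theta> * (of_real t * a n) = of_real (cmod (of_real t * a n)) * cis (Arg (a (2 * n)))"
      unfolding \<theta>_def by (metis (no_types, lifting) cis_mult mult.left_commute diff_add_cancel)
    ultimately have "a (2 * n) + \<theta> * (of_real t * a n)
        = of_real (cmod (a (2 * n)) + cmod (of_real t * a n)) * cis (Arg (a (2 * n)))"
      by (metis distrib_right of_real_add)
    then have "cmod (a (2 * n) + \<theta> * (of_real t * a n)) = cmod (a (2 * n)) + t * cmod (a n)"
      using t0 by (simp only: norm_mult norm_cis norm_of_real) simp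
    with that[of \<theta>] show ?thesis by (simp add: \<theta>_def)
  qed
  have "t = cmod (a n) - t * cmod (a 0)"
    using den by (simp add: t_def field_simps)
  also have "\<dots> = cmod (a n) - cmod (\<theta> * of_real t * a 0)"
    using \<theta> t0 by (simp add: norm_mult)
  also have "\<dots> \<le> cmod (a n + \<theta> * of_real t * a 0)"
    by (rule norm_diff_ineq)
  finally have "cmod (a (2 * n) + \<theta> * of_real t * a (2 * n - n)) \<le> 1 - (\<Sum>k<n. (cmod (a k))\<^sup>2)"
    using n \<theta>(1) t0 by (intro leading_coefficient_bound assms) (auto simp: norm_mult)
  moreover have "t * cmod (a n) = (cmod (a n))\<^sup>2 / (1 + cmod (a 0))"
    by (simp add: t_def power2_eq_square)
  ultimately show ?thesis using \<theta>(2) by (simp add: mult.assoc)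
qed

section \<open>The one-variable inequality and the Bohr radius\<close>

text \<open>Carlson's inequalities are summed in pairs. The third term on the left is what they leave for
  the coefficients of index above \<open>2 n\<close>, namely \<open>1 - \<Sum>\<^sub>k\<^sub>\<le>\<^sub>n |a\<^sub>k|\<^sup>2\<close> times the geometric tail of \<open>t\<close>.
  Passing from \<open>n\<close> to \<open>n + 1\<close>, the multiples of \<open>|a\<^bsub>n+1\<^esub>|\<^sup>2\<close> cancel exactly: the even inequality
  yields \<open>1 / (1 + |a\<^sub>0|)\<close> and the shrinking of the tail yields \<open>t / (1 - t)\<close>. This is where the
  factor in front of the sum of squares comes from.\<close>

lemma bohr_partial_sum_bound:
  fixes a :: "nat \<Rightarrow> complex" and t :: real
  assumes summ: "summable (\<lambda>k. cmod (a k))"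
    and bound: "\<And>z. cmod z = 1 \<Longrightarrow> cmod (\<Sum>k. a k * z ^ k) \<le> 1"
    and t: "0 \<le> t" "t < 1"
  shows "(\<Sum>k<2 * n. cmod (a (Suc k)) * t ^ Suc k)
           + (1 / (1 + cmod (a 0)) + t / (1 - t)) * (\<Sum>k<n. (cmod (a (Suc k)) * t ^ Suc k)\<^sup>2)
           + (1 - (\<Sum>k\<le>n. (cmod (a k))\<^sup>2)) * (t ^ (2 * n + 1) / (1 - t))
         \<le> (1 - (cmod (a 0))\<^sup>2) * (t / (1 - t))"
proof (induction n)
  case 0
  show ?case by simp
next
  case (Suc n)
  define A where "A = 1 / (1 + cmod (a 0))"
  define S where "S = (\<Sum>k\<le>n. (cmod (a k))\<^sup>2)"
  define x where "x = (cmod (a (Suc n)))\<^sup>2"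
  define T where "T = t ^ (2 * n + 1)"
  have T: "T \<ge> 0" using t by (simp add: T_def)
  have "cmod (a (2 * n + 1)) \<le> 1 - S"
    unfolding S_def by (rule carlson_odd[OF summ bound])
  then have odd: "cmod (a (2 * n + 1)) * T \<le> (1 - S) * T"
    using T by (rule mult_right_mono)
  have "cmod (a (2 * n + 2)) \<le> 1 - S - A * x"
    using carlson_even[OF summ bound, of "Suc n"]
    unfolding S_def x_def A_def by (simp add: lessThan_Suc_atMost)
  then have even: "cmod (a (2 * n + 2)) * (T * t) \<le> (1 - S - A * x) * (T * t)"
    using T t by (intro mult_right_mono) auto
  have pw: "t ^ (2 * n + 2) = T * t" "t ^ (2 * n + 3) = T * t * t"
    by (simp_all add: T_def power_add power2_eq_square power3_eq_cube)
  have sq: "(t ^ Suc n)\<^sup>2 = T * t"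
    by (simp add: T_def power2_eq_square flip: power_add mult_2)
  have geom: "T * t * t / (1 - t) = T * t * (t / (1 - t))"
      "T / (1 - t) = T + T * t + T * t * (t / (1 - t))"
    using t by (simp_all add: divide_simps) (simp add: algebra_simps)
  have sumodd: "(\<Sum>k<2 * Suc n. cmod (a (Suc k)) * t ^ Suc k)
      = (\<Sum>k<2 * n. cmod (a (Suc k)) * t ^ Suc k) + cmod (a (2 * n + 1)) * T
        + cmod (a (2 * n + 2)) * (T * t)"
    using pw by (simp add: T_def)
  have sumsq: "(\<Sum>k<Suc n. (cmod (a (Suc k)) * t ^ Suc k)\<^sup>2)
      = (\<Sum>k<n. (cmod (a (Suc k)) * t ^ Suc k)\<^sup>2) + x * (T * t)"
    by (simp only: sum.lessThan_Suc power_mult_distrib sq x_def)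
  have sumall: "(\<Sum>k\<le>Suc n. (cmod (a k))\<^sup>2) = S + x"
    by (simp add: S_def x_def)
  have pw3: "t ^ (2 * Suc n + 1) = T * t * t"
    using pw(2) by (simp add: eval_nat_numeral)
  \<comment> \<open>the balance of one step; all terms in \<open>x\<close> cancel\<close>
  have key: "(1 - S) * T + (1 - S - A * x) * (T * t) + (A + t / (1 - t)) * (x * (T * t))
       + (1 - (S + x)) * (T * t * t / (1 - t)) = (1 - S) * (T / (1 - t))"
    unfolding geom by (simp only: algebra_simps)
  show ?case
    using Suc.IH odd even key
    unfolding sumodd sumsq sumall pw3 A_def[symmetric] S_def[symmetric] T_def[symmetric]
    by (simp add: distrib_left)
qed

text \<open>The one-variable inequality: in the limit the tail term is dropped, being nonnegative by
  \<open>\<Sum>|a\<^sub>k|\<^sup>2 \<le> 1\<close>.\<close>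

lemma bohr_inequality_disc:
  fixes a :: "nat \<Rightarrow> complex" and t :: real
  assumes summ: "summable (\<lambda>k. cmod (a k))"
    and bound: "\<And>z. cmod z = 1 \<Longrightarrow> cmod (\<Sum>k. a k * z ^ k) \<le> 1"
    and t: "0 \<le> t" "t < 1"
  defines "b \<equiv> \<lambda>k. cmod (a (Suc k)) * t ^ Suc k"
  shows "summable b" and "summable (\<lambda>k. (b k)\<^sup>2)"
    and "(\<Sum>k. b k) + (1 / (1 + cmod (a 0)) + t / (1 - t)) * (\<Sum>k. (b k)\<^sup>2)
           \<le> (1 - (cmod (a 0))\<^sup>2) * (t / (1 - t))"
proof -
  have bessel: "(\<Sum>k\<le>n. (cmod (a k))\<^sup>2) \<le> 1" for n
    using order_trans[OF norm_ge_zero carlson_odd[OF summ bound, of n]] by simp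
  have b0: "b k \<ge> 0" for k using t by (simp add: b_def)
  have a1: "cmod (a k) \<le> 1" for k
  proof -
    have "(cmod (a k))\<^sup>2 \<le> (\<Sum>k\<le>k. (cmod (a k))\<^sup>2)"
      by (rule member_le_sum) auto
    also note bessel
    finally show ?thesis by (simp add: abs_square_le_1)
  qed
  have b1: "b k \<le> 1" for k
    unfolding b_def using mult_mono[OF a1 power_le_one[OF t(1), of "Suc k"]] t by simp
  show sb: "summable b"
  proof (rule summable_comparison_test')
    show "summable (\<lambda>k. cmod (a (Suc k)))" using summ by (subst summable_Suc_iff)
    show "norm (b k) \<le> cmod (a (Suc k))" if "0 \<le> k" for k
      using t power_le_one[OF t(1), of "Suc k"] unfolding b_def
      by (simp add: abs_mult mult_left_le del: power_Suc)
  qed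
  show sb2: "summable (\<lambda>k. (b k)\<^sup>2)"
  proof (rule summable_comparison_test'[OF sb])
    show "norm ((b k)\<^sup>2) \<le> b k" if "0 \<le> k" for k
      using b0 b1[of k] by (simp add: power2_eq_square mult_left_le)
  qed
  have part: "(\<Sum>k<2 * n. b k) + (1 / (1 + cmod (a 0)) + t / (1 - t)) * (\<Sum>k<n. (b k)\<^sup>2)
         \<le> (1 - (cmod (a 0))\<^sup>2) * (t / (1 - t))" for n
  proof -
    have "(1 - (\<Sum>k\<le>n. (cmod (a k))\<^sup>2)) * (t ^ (2 * n + 1) / (1 - t)) \<ge> 0"
      using bessel[of n] t by (intro mult_nonneg_nonneg) auto
    with bohr_partial_sum_bound[OF summ bound t, of n] show ?thesis
      unfolding b_def by linarith
  qed
  have "(\<lambda>n. \<Sum>k<2 * n. b k) \<longlonglongrightarrow> (\<Sum>k. b k)"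
    using filterlim_compose[OF summable_LIMSEQ[OF sb], of "\<lambda>n. 2 * n" sequentially]
    by (simp add: filterlim_subseq strict_mono_def)
  then have "(\<lambda>n. (\<Sum>k<2 * n. b k) + (1 / (1 + cmod (a 0)) + t / (1 - t)) * (\<Sum>k<n. (b k)\<^sup>2))
      \<longlonglongrightarrow> (\<Sum>k. b k) + (1 / (1 + cmod (a 0)) + t / (1 - t)) * (\<Sum>k. (b k)\<^sup>2)"
    by (intro tendsto_intros summable_LIMSEQ sb2)
  then show "(\<Sum>k. b k) + (1 / (1 + cmod (a 0)) + t / (1 - t)) * (\<Sum>k. (b k)\<^sup>2)
           \<le> (1 - (cmod (a 0))\<^sup>2) * (t / (1 - t))"
    by (rule tendsto_upperbound) (use part in auto)
qed

lemma bohr_radius_bounds: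
  assumes "0 < p" "0 \<le> a" "a < 1"
  shows "a\<^sup>2 < 1" "a powr p < 1" "0 < bohr_radius p a" "bohr_radius p a < 1"
proof -
  show a2: "a\<^sup>2 < 1" using assms by (simp add: abs_square_less_1)
  show ap: "a powr p < 1"
    using assms powr_less_mono2[of p a 1] by simp
  show "0 < bohr_radius p a" "bohr_radius p a < 1"
    using a2 ap unfolding bohr_radius_def by (simp_all add: field_simps)
qed

text \<open>The radius is the solution \<open>t\<close> of \<open>a\<^sup>p + (1 - a\<^sup>2) t / (1 - t) = 1\<close>, that is, the point where the
  upper bound of the one-variable inequality uses up the available \<open>1 - a\<^sup>p\<close>.\<close>

lemma bohr_radius_iff:
  assumes "0 < p" "0 \<le> a" "a < 1" and t: "t < 1"
  shows "a powr p + (1 - a\<^sup>2) * (t / (1 - t)) \<le> 1 \<longleftrightarrow> t \<le> bohr_radius p a"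
proof -
  have "2 - a\<^sup>2 - a powr p > 0" using bohr_radius_bounds(1,2)[OF assms(1-3)] by simp
  then show ?thesis using t unfolding bohr_radius_def by (simp add: field_simps)
qed

section \<open>Homogeneous polynomials in several variables\<close>

lemma finite_multi_indices:
  "finite {\<alpha> :: 'n::finite \<Rightarrow> nat. (\<Sum>i\<in>UNIV. \<alpha> i) = k}"
proof (rule finite_subset)
  show "{\<alpha> :: 'n \<Rightarrow> nat. (\<Sum>i\<in>UNIV. \<alpha> i) = k} \<subseteq> (\<Pi>\<^sub>E i\<in>UNIV. {..k})"
    by (auto intro: member_le_sum)
qed (simp add: finite_PiE)

lemma homogeneous_polynomial_scale:
  assumes "homogeneous_polynomial k P"
  shows "P (\<xi> *s z) = \<xi> ^ k * P z"
proof -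
  obtain c where c: "\<And>z. P z = (\<Sum>\<alpha> | (\<Sum>i\<in>UNIV. \<alpha> i) = k. c \<alpha> * (\<Prod>i\<in>UNIV. (z $ i) ^ \<alpha> i))"
    using assms unfolding homogeneous_polynomial_def by blast
  show ?thesis
    unfolding c sum_distrib_left
    by (intro sum.cong refl) (auto simp: power_mult_distrib prod.distrib simp flip: power_sum)
qed

lemma homogeneous_polynomial_monomial:
  fixes \<alpha> :: "'n::finite \<Rightarrow> nat"
  assumes "(\<Sum>i\<in>UNIV. \<alpha> i) = k"
  shows "homogeneous_polynomial k (\<lambda>z. b * (\<Prod>i\<in>UNIV. (z $ i) ^ \<alpha> i))"
  unfolding homogeneous_polynomial_def
proof (intro exI allI)
  fix z :: "complex ^ 'n"
  show "b * (\<Prod>i\<in>UNIV. (z $ i) ^ \<alpha> i)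
      = (\<Sum>\<gamma> | (\<Sum>i\<in>UNIV. \<gamma> i) = k. (if \<gamma> = \<alpha> then b else 0) * (\<Prod>i\<in>UNIV. (z $ i) ^ \<gamma> i))"
    using assms finite_multi_indices[where 'n = 'n and k = k] by (simp add: if_distrib[of "\<lambda>x. x * _"] cong: if_cong)
qed

lemma homogeneous_polynomial_sum:
  assumes "finite I" "\<And>j. j \<in> I \<Longrightarrow> homogeneous_polynomial k (P j)"
  shows "homogeneous_polynomial k (\<lambda>z. \<Sum>j\<in>I. P j z)"
proof -
  obtain c where c: "\<And>j z. j \<in> I \<Longrightarrow>
      P j z = (\<Sum>\<alpha> | (\<Sum>i\<in>UNIV. \<alpha> i) = k. c j \<alpha> * (\<Prod>i\<in>UNIV. (z $ i) ^ \<alpha> i))"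
    using assms(2) unfolding homogeneous_polynomial_def by metis
  show ?thesis
    unfolding homogeneous_polynomial_def
  proof (intro exI allI)
    fix z
    have "(\<Sum>j\<in>I. P j z)
        = (\<Sum>j\<in>I. \<Sum>\<alpha> | (\<Sum>i\<in>UNIV. \<alpha> i) = k. c j \<alpha> * (\<Prod>i\<in>UNIV. (z $ i) ^ \<alpha> i))"
      by (intro sum.cong refl c)
    also have "\<dots> = (\<Sum>\<alpha> | (\<Sum>i\<in>UNIV. \<alpha> i) = k. (\<Sum>j\<in>I. c j \<alpha>) * (\<Prod>i\<in>UNIV. (z $ i) ^ \<alpha> i))"
      by (subst sum.swap) (simp add: sum_distrib_right)
    finally show "(\<Sum>j\<in>I. P j z)
        = (\<Sum>\<alpha> | (\<Sum>i\<in>UNIV. \<alpha> i) = k. (\<Sum>j\<in>I. c j \<alpha>) * (\<Prod>i\<in>UNIV. (z $ i) ^ \<alpha> i))" .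
  qed
qed

lemma homogeneous_polynomial_mult_coordinate:
  fixes P :: "complex ^ 'n \<Rightarrow> complex"
  assumes "homogeneous_polynomial k P"
  shows "homogeneous_polynomial (Suc k) (\<lambda>z. z $ i * P z)"
proof -
  obtain c where c: "\<And>z. P z = (\<Sum>\<alpha> | (\<Sum>i\<in>UNIV. \<alpha> i) = k. c \<alpha> * (\<Prod>i\<in>UNIV. (z $ i) ^ \<alpha> i))"
    using assms unfolding homogeneous_polynomial_def by blast
  define up where "up \<alpha> = (\<lambda>j. \<alpha> j + (if j = i then 1 else 0 :: nat))" for \<alpha> :: "'n \<Rightarrow> nat"
  have "z $ i * P z = (\<Sum>\<alpha> | (\<Sum>i\<in>UNIV. \<alpha> i) = k. c \<alpha> * (\<Prod>j\<in>UNIV. (z $ j) ^ up \<alpha> j))" for z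
  proof -
    have "(\<Prod>j\<in>UNIV. (z $ j) ^ up \<alpha> j) = z $ i * (\<Prod>j\<in>UNIV. (z $ j) ^ \<alpha> j)" for \<alpha>
      by (simp add: up_def power_add prod.distrib if_distrib[of "\<lambda>n. _ ^ n"] cong: if_cong)
    then show ?thesis unfolding c by (simp add: sum_distrib_left mult_ac)
  qed
  moreover have "homogeneous_polynomial (Suc k)
      (\<lambda>z. \<Sum>\<alpha> | (\<Sum>i\<in>UNIV. \<alpha> i) = k. c \<alpha> * (\<Prod>j\<in>UNIV. (z $ j) ^ up \<alpha> j))"
    by (intro homogeneous_polynomial_sum finite_multi_indices homogeneous_polynomial_monomial)
      (simp add: up_def sum.distrib)
  ultimately show ?thesis by presburger
qed

text \<open>Multiplying by one coordinate at a time avoids multinomial coefficients.\<close>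

lemma homogeneous_polynomial_linear_power:
  fixes l :: "'n::finite \<Rightarrow> complex"
  shows "homogeneous_polynomial k (\<lambda>z. b * (\<Sum>i\<in>UNIV. l i * z $ i) ^ k)"
proof (induction k arbitrary: b)
  case 0
  show ?case using homogeneous_polynomial_monomial[of "\<lambda>_. 0" 0 b] by simp
next
  case (Suc k)
  have "homogeneous_polynomial (Suc k)
      (\<lambda>z. \<Sum>j\<in>UNIV. z $ j * ((b * l j) * (\<Sum>i\<in>UNIV. l i * z $ i) ^ k))"
    by (intro homogeneous_polynomial_sum homogeneous_polynomial_mult_coordinate Suc.IH) simp
  also have "(\<lambda>z. \<Sum>j\<in>UNIV. z $ j * ((b * l j) * (\<Sum>i\<in>UNIV. l i * z $ i) ^ k))
      = (\<lambda>z. b * (\<Sum>i\<in>UNIV. l i * z $ i) ^ Suc k)"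
    by (simp add: fun_eq_iff sum_distrib_left sum_distrib_right mult_ac)
  finally show ?case .
qed

section \<open>The inequality on circular domains\<close>

lemma scaleR_eq_vector_smult: "t *\<^sub>R (z :: complex ^ 'n) = of_real t *s z"
  unfolding vec_eq_iff vector_scaleR_component by (simp add: scaleR_conv_of_real)

text \<open>Points of an open set can be pushed slightly outwards. This gives absolute convergence of the
  expansion at each point of the domain, and strictness of the estimate for the extremal
  functional.\<close>

lemma open_dilation:
  fixes Q :: "'a::real_normed_vector set"
  assumes "open Q" "z \<in> Q"
  obtains s where "s > 1" "s *\<^sub>R z \<in> Q"
proof -
  have "((\<lambda>s. s *\<^sub>R z) \<longlongrightarrow> 1 *\<^sub>R z) (at_right (1::real))"
    by (intro tendsto_intros)
  then have "eventually (\<lambda>s. s *\<^sub>R z \<in> Q) (at_right (1::real))"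
    using assms by (auto elim!: topological_tendstoD)
  moreover have "eventually (\<lambda>s. s > (1::real)) (at_right 1)"
    by (rule eventually_at_right_less)
  ultimately have "eventually (\<lambda>s. s > 1 \<and> s *\<^sub>R z \<in> Q) (at_right (1::real))"
    by eventually_elim simp
  then show ?thesis using that eventually_happens'[of "at_right (1::real)"] by auto
qed

text \<open>Along a complex line \<open>\<xi> \<mapsto> \<xi> w\<close> the homogeneous expansion becomes the power series with
  coefficients \<open>P\<^sub>k w\<close>, bounded by 1 on the closed unit disc, and the one-variable inequality
  applies. Absolute summability at \<open>\<xi> = 1\<close> comes from convergence at some real \<open>\<xi> > 1\<close>.\<close>

lemma bohr_inequality_circular_domain:
  fixes Q :: "(complex ^ 'n) set"
  assumes Q: "complete_circular_domain Q" and p: "0 < p"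
    and expan: "homogeneous_expansion_on f P Q"
    and f1: "\<forall>z\<in>Q. cmod (f z) < 1"
    and z: "z \<in> homothetic (bohr_radius p (cmod (f 0))) Q"
    and r: "0 \<le> r" "r \<le> bohr_radius p (cmod (f 0))"
  shows "bohr_summable P z \<and> bohr_sum p (1 / (1 + cmod (f 0))) r f P z \<le> 1"
proof -
  have oQ: "open Q" and Q0: "0 \<in> Q"
    and circ: "\<And>w \<xi>. w \<in> Q \<Longrightarrow> cmod \<xi> \<le> 1 \<Longrightarrow> \<xi> *s w \<in> Q"
    using Q unfolding complete_circular_domain_def by auto
  have hom: "\<And>k. homogeneous_polynomial k (P k)" and sums: "\<And>w. w \<in> Q \<Longrightarrow> (\<lambda>k. P k w) sums f w"
    using expan unfolding homogeneous_expansion_on_def by auto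
  define t where "t = bohr_radius p (cmod (f 0))"
  obtain w where w: "w \<in> Q" and zw: "z = t *\<^sub>R w"
    using z unfolding homothetic_def t_def by auto
  have f01: "cmod (f 0) < 1" using f1 Q0 by blast
  have t: "0 < t" "t < 1"
    using bohr_radius_bounds[OF p norm_ge_zero f01] unfolding t_def by auto
  define a where "a k = P k w" for k
  have P_scale: "P k (\<xi> *s w) = a k * \<xi> ^ k" for k \<xi>
    using homogeneous_polynomial_scale[OF hom] by (simp add: a_def mult.commute)
  have a_sums: "(\<lambda>k. a k * \<xi> ^ k) sums f (\<xi> *s w)" if "\<xi> *s w \<in> Q" for \<xi>
    using sums[OF that] by (simp add: P_scale)
  have summ: "summable (\<lambda>k. cmod (a k))"
  proof -
    obtain s where s: "s > 1" "s *\<^sub>R w \<in> Q" using open_dilation[OF oQ w] .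
    then have "summable (\<lambda>k. a k * of_real s ^ k)"
      using a_sums[of "of_real s"] by (auto simp: scaleR_eq_vector_smult sums_iff)
    from powser_insidea[OF this, of 1] s(1) show ?thesis by simp
  qed
  have bound: "cmod (\<Sum>k. a k * \<xi> ^ k) \<le> 1" if "cmod \<xi> = 1" for \<xi>
  proof -
    have "\<xi> *s w \<in> Q" using circ w that by simp
    with a_sums f1 show ?thesis by (metis sums_unique less_imp_le)
  qed
  have a0: "a 0 = f 0"
    using sums_unique2[OF a_sums[of 0] powser_sums_zero] circ[OF w, of 0] by simp
  have Pz: "cmod (P k z) = cmod (a k) * t ^ k" for k
    using t by (simp add: zw scaleR_eq_vector_smult P_scale norm_mult norm_power)
  note disc = bohr_inequality_disc[OF summ bound, of t, unfolded a0]
  have "bohr_summable P z"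
    using disc t unfolding bohr_summable_def Pz by simp
  moreover have "bohr_sum p (1 / (1 + cmod (f 0))) r f P z \<le> 1"
  proof -
    define S where "S = (\<Sum>k. (cmod (a (Suc k)) * t ^ Suc k)\<^sup>2)"
    have S: "S \<ge> 0" unfolding S_def using disc(2) t by (intro suminf_nonneg) auto
    have "r / (1 - r) \<le> t / (1 - t)"
      using r t unfolding t_def[symmetric] by (intro frac_le) auto
    with S have "(r / (1 - r)) * S \<le> (t / (1 - t)) * S" by (rule mult_right_mono[rotated])
    moreover have "(\<Sum>k. cmod (a (Suc k)) * t ^ Suc k) + (1 / (1 + cmod (f 0)) + t / (1 - t)) * S
        \<le> (1 - (cmod (f 0))\<^sup>2) * (t / (1 - t))"
      using disc(3) t unfolding S_def by simp
    moreover have "cmod (f 0) powr p + (1 - (cmod (f 0))\<^sup>2) * (t / (1 - t)) \<le> 1"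
      using t by (subst bohr_radius_iff[OF p norm_ge_zero f01]) (auto simp: t_def)
    ultimately show ?thesis
      unfolding bohr_sum_def Pz S_def[symmetric] by (simp add: distrib_right)
  qed
  ultimately show ?thesis by blast
qed

section \<open>Extremal functions on convex domains\<close>

text \<open>Convexity provides a real functional bounded on \<open>Q\<close>; it is the real part of a complex-linear
  one, \<open>L\<close>, and since \<open>Q\<close> is invariant under rotations the real bound is a bound of \<open>|L|\<close>. Divided by
  its supremum, \<open>L\<close> maps \<open>Q\<close> onto the unit disc; circularity allows prescribing a real value.\<close>

lemma extremal_linear_functional:
  fixes Q :: "(complex ^ 'n) set"
  assumes Q: "complete_circular_domain Q" and "convex Q" "Q \<noteq> UNIV"
  obtains l :: "'n \<Rightarrow> complex"
  where "\<And>z. z \<in> Q \<Longrightarrow> cmod (\<Sum>i\<in>UNIV. l i * z $ i) < 1"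
    and "\<And>t. 0 \<le> t \<Longrightarrow> t < 1 \<Longrightarrow> \<exists>z\<in>Q. (\<Sum>i\<in>UNIV. l i * z $ i) = complex_of_real t"
proof -
  have oQ: "open Q" and Q0: "0 \<in> Q"
    and circ: "\<And>w \<xi>. w \<in> Q \<Longrightarrow> cmod \<xi> \<le> 1 \<Longrightarrow> \<xi> *s w \<in> Q"
    using Q unfolding complete_circular_domain_def by auto
  obtain w where "w \<notin> Q" using \<open>Q \<noteq> UNIV\<close> by auto
  then obtain v b where v: "v \<noteq> 0" and vb: "\<And>x. x \<in> Q \<Longrightarrow> inner v x \<le> b"
    using separating_hyperplane_sets[of Q "{w}"] \<open>convex Q\<close> Q0 by auto
  define L where "L z = (\<Sum>i\<in>UNIV. cnj (v $ i) * z $ i)" for z :: "complex ^ 'n"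
  have Re_L: "Re (L z) = inner v z" for z
    by (simp add: L_def inner_vec_def inner_complex_def)
  have L_scale: "L (c *s z) = c * L z" for c z
    by (simp add: L_def sum_distrib_left mult_ac)
  have L_bdd: "cmod (L z) \<le> b" if z: "z \<in> Q" for z
  proof (cases "L z = 0")
    case True
    then show ?thesis using vb[OF Q0] by simp
  next
    case False
    \<comment> \<open>the rotation that makes \<open>L z\<close> real and nonnegative\<close>
    define \<xi> where "\<xi> = cnj (L z) / of_real (cmod (L z))"
    have "cmod \<xi> = 1" using False by (simp add: \<xi>_def norm_divide)
    then have "inner v (\<xi> *s z) \<le> b" using circ[OF z] by (intro vb) simp
    moreover have "L (\<xi> *s z) = of_real (cmod (L z))"
      using False complex_norm_square[of "L z"]
      by (simp add: L_scale \<xi>_def field_simps power2_eq_square)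
    ultimately show ?thesis by (simp flip: Re_L)
  qed
  define m where "m = (SUP z\<in>Q. cmod (L z))"
  have bdd: "bdd_above ((\<lambda>z. cmod (L z)) ` Q)" using L_bdd by (auto simp: bdd_above_def)
  have le_m: "cmod (L z) \<le> m" if "z \<in> Q" for z
    unfolding m_def using bdd that by (rule cSUP_upper2) simp
  have m0: "m > 0"
  proof -
    obtain e where e: "e > 0" "ball 0 e \<subseteq> Q" using oQ Q0 open_contains_ball by blast
    define z where "z = (e / (2 * norm v)) *\<^sub>R v"
    have "norm z < e" using e v by (simp add: z_def)
    then have "z \<in> Q" using e by auto
    moreover have "inner v z > 0" using e v by (simp add: z_def)
    ultimately show ?thesis using le_m[of z] complex_Re_le_cmod[of "L z"] by (simp add: Re_L)
  qed
  have less_m: "cmod (L z) < m" if z: "z \<in> Q" for z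
  proof (cases "L z = 0")
    case False
    obtain s where s: "s > 1" "s *\<^sub>R z \<in> Q" using open_dilation[OF oQ z] .
    have "cmod (L z) < s * cmod (L z)" using s False by simp
    also have "\<dots> = cmod (L (s *\<^sub>R z))" using s by (simp add: scaleR_eq_vector_smult L_scale norm_mult)
    also have "\<dots> \<le> m" using s by (intro le_m)
    finally show ?thesis .
  qed (use m0 in simp)
  define l where "l i = cnj (v $ i) / of_real m" for i
  have l: "(\<Sum>i\<in>UNIV. l i * z $ i) = L z / of_real m" for z
    by (simp add: l_def L_def sum_divide_distrib)
  show ?thesis
  proof (rule that[of l])
    show "cmod (\<Sum>i\<in>UNIV. l i * z $ i) < 1" if "z \<in> Q" for z
      using less_m[OF that] m0 by (simp add: l norm_divide)
    show "\<exists>z\<in>Q. (\<Sum>i\<in>UNIV. l i * z $ i) = complex_of_real t" if t: "0 \<le> t" "t < 1" for t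
    proof -
      have "t * m < m" using t m0 by simp
      then obtain z where z: "z \<in> Q" "t * m < cmod (L z)"
        unfolding m_def using less_cSUP_iff[OF _ bdd] Q0 by auto
      have Lz: "cmod (L z) > 0" using z t m0 by (meson le_less_trans mult_nonneg_nonneg less_imp_le)
      define \<xi> where "\<xi> = of_real (t * m) / L z"
      have "cmod \<xi> \<le> 1" using z t m0 Lz by (simp add: \<xi>_def norm_divide norm_mult)
      then have "\<xi> *s z \<in> Q" by (rule circ[OF z(1)])
      moreover have "(\<Sum>i\<in>UNIV. l i * (\<xi> *s z) $ i) = of_real t"
        unfolding l L_scale using Lz m0 by (simp add: \<xi>_def)
      ultimately show ?thesis by blast
    qed
  qed
qed

text \<open>Taylor coefficients at 0 of the disc automorphism \<open>w \<mapsto> (a - w) / (1 - a w)\<close>.\<close>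

definition mobius_coeff :: "real \<Rightarrow> nat \<Rightarrow> complex" where
  "mobius_coeff a k = (case k of 0 \<Rightarrow> of_real a | Suc j \<Rightarrow> - of_real ((1 - a\<^sup>2) * a ^ j))"

lemma mobius_coeff_sums:
  assumes a: "0 \<le> a" "a < 1" and w: "cmod w < 1"
  shows "(\<lambda>k. mobius_coeff a k * w ^ k) sums ((of_real a - w) / (1 - of_real a * w))"
proof -
  have aw: "cmod (of_real a * w) < 1"
    using mult_strict_mono'[of a 1 "cmod w" 1] a w by (simp add: norm_mult)
  then have ne: "1 - of_real a * w \<noteq> 0" by auto
  have "(\<lambda>k. - of_real (1 - a\<^sup>2) * w * (of_real a * w) ^ k)
      sums (- of_real (1 - a\<^sup>2) * w * (1 / (1 - of_real a * w)))"
    by (intro sums_mult geometric_sums aw)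
  moreover have "(\<lambda>k. - of_real (1 - a\<^sup>2) * w * (of_real a * w) ^ k)
      = (\<lambda>k. mobius_coeff a (Suc k) * w ^ Suc k)"
    by (rule ext) (simp add: mobius_coeff_def power_mult_distrib algebra_simps)
  ultimately have "(\<lambda>k. mobius_coeff a (Suc k) * w ^ Suc k)
      sums (- of_real (1 - a\<^sup>2) * w * (1 / (1 - of_real a * w)))"
    by simp
  then have "(\<lambda>k. mobius_coeff a k * w ^ k)
      sums (- of_real (1 - a\<^sup>2) * w * (1 / (1 - of_real a * w)) + of_real a)"
    by (subst (asm) sums_Suc_iff) (simp add: mobius_coeff_def)
  also have "- of_real (1 - a\<^sup>2) * w * (1 / (1 - of_real a * w)) + of_real a
      = (of_real a - w) / (1 - of_real a * w)"
    using ne by (simp add: field_simps power2_eq_square)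
  finally show ?thesis .
qed

lemma mobius_norm_less_1:
  assumes a: "0 \<le> a" "a < 1" and w: "cmod w < 1"
  shows "cmod ((of_real a - w) / (1 - of_real a * w)) < 1"
proof -
  have w2: "(cmod w)\<^sup>2 < 1" and a2: "a\<^sup>2 < 1" using a w by (simp_all add: abs_square_less_1)
  have "(cmod (1 - of_real a * w))\<^sup>2 - (cmod (of_real a - w))\<^sup>2 = (1 - a\<^sup>2) * (1 - (cmod w)\<^sup>2)"
    by (simp add: cmod_power2) (simp add: algebra_simps power2_eq_square)
  also have "\<dots> > 0" using w2 a2 by simp
  finally have "(cmod (of_real a - w))\<^sup>2 < (cmod (1 - of_real a * w))\<^sup>2" by linarith
  then have "cmod (of_real a - w) < cmod (1 - of_real a * w)"
    by (rule power2_less_imp_less) simp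
  then show ?thesis by (simp add: norm_divide divide_less_eq)
qed

lemma holomorphic_mobius_linear:
  fixes l :: "'n::finite \<Rightarrow> complex"
  assumes a: "0 \<le> a" "a < 1"
    and l: "\<And>z. z \<in> Q \<Longrightarrow> cmod (\<Sum>i\<in>UNIV. l i * z $ i) < 1"
  shows "holomorphic_Cn_on (\<lambda>z. (of_real a - (\<Sum>i\<in>UNIV. l i * z $ i))
           / (1 - of_real a * (\<Sum>i\<in>UNIV. l i * z $ i))) Q"
  unfolding holomorphic_Cn_on_def
proof
  fix z assume z: "z \<in> Q"
  define L where "L z = (\<Sum>i\<in>UNIV. l i * z $ i)" for z :: "complex ^ 'n"
  define \<phi> where "\<phi> w = (of_real a - w) / (1 - of_real a * w)" for w :: complex
  have "cmod (of_real a * L z) < 1"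
    using mult_strict_mono'[of a 1 "cmod (L z)" 1] a l[OF z] by (simp add: norm_mult L_def)
  then have ne: "1 - of_real a * L z \<noteq> 0" by auto
  have "bounded_linear L"
    unfolding L_def by (intro bounded_linear_sum bounded_linear_const_mult bounded_linear_vec_nth)
  then have dL: "(L has_derivative L) (at z)" by (rule bounded_linear_imp_has_derivative)
  have "\<phi> field_differentiable (at (L z))"
    unfolding \<phi>_def using ne by (intro derivative_intros) auto
  then obtain D where "(\<phi> has_derivative (*) D) (at (L z))"
    unfolding field_differentiable_def has_field_derivative_def by auto
  from diff_chain_at[OF dL this] have "((\<lambda>z. \<phi> (L z)) has_derivative (\<lambda>v. D * L v)) (at z)"
    by (simp add: o_def)
  moreover have "D * L (c *s v) = c * (D * L v)" for c v
    by (simp add: L_def sum_distrib_left mult_ac)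
  ultimately show "\<exists>D. ((\<lambda>z. (of_real a - (\<Sum>i\<in>UNIV. l i * z $ i))
           / (1 - of_real a * (\<Sum>i\<in>UNIV. l i * z $ i))) has_derivative D) (at z)
        \<and> (\<forall>c v. D (c *s v) = c * D v)"
    unfolding \<phi>_def L_def by blast
qed

text \<open>For the disc automorphism the one-variable inequality is an equality, for every \<open>t\<close> with
  \<open>r = t\<close>. The key is \<open>1 / (1 + a) + t / (1 - t) = (1 + a t) / ((1 + a) (1 - t))\<close>, whose numerator
  cancels a factor of \<open>1 - a\<^sup>2 t\<^sup>2\<close>. Another constant \<open>c\<close> only adds a multiple of the sum of
  squares.\<close>

lemma bohr_sum_extremal:
  assumes a: "0 \<le> a" "a < 1" and t: "0 \<le> t" "t < 1"
    and f0: "cmod (f 0) = a" and Pz: "\<And>k. P k z = mobius_coeff a k * of_real t ^ k"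
  shows "bohr_summable P z"
    and "bohr_sum p c t f P z = a powr p + (1 - a\<^sup>2) * (t / (1 - t))
           + (c - 1 / (1 + a)) * ((1 - a\<^sup>2)\<^sup>2 * t\<^sup>2 / (1 - a\<^sup>2 * t\<^sup>2))"
proof -
  have a2: "a\<^sup>2 < 1" using a by (simp add: abs_square_less_1)
  have at: "0 \<le> a * t" "a * t < 1"
    using a t mult_strict_mono'[of a 1 t 1] by auto
  then have at2: "(a * t)\<^sup>2 < 1" by (simp add: abs_square_less_1)
  have n: "cmod (P (Suc k) z) = (1 - a\<^sup>2) * t * (a * t) ^ k" for k
    using a t a2 unfolding Pz mobius_coeff_def
    by (simp add: norm_mult norm_power power_mult_distrib abs_mult del: of_real_mult of_real_diff of_real_power)
  then have n2: "(cmod (P (Suc k) z))\<^sup>2 = ((1 - a\<^sup>2) * t)\<^sup>2 * ((a * t)\<^sup>2) ^ k" for k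
    by (simp add: power_mult_distrib power_mult[symmetric] mult.commute)
  have s1: "(\<lambda>k. cmod (P (Suc k) z)) sums ((1 - a\<^sup>2) * t * (1 / (1 - a * t)))"
    unfolding n using at by (intro sums_mult geometric_sums) simp
  have s2: "(\<lambda>k. (cmod (P (Suc k) z))\<^sup>2) sums (((1 - a\<^sup>2) * t)\<^sup>2 * (1 / (1 - (a * t)\<^sup>2)))"
    unfolding n2 using at2 by (intro sums_mult geometric_sums) simp
  show "bohr_summable P z"
    unfolding bohr_summable_def using s1 s2 by (auto simp: sums_iff)
  define u where "u = 1 - a * t"
  define v where "v = 1 + a * t"
  have uv: "1 - (a * t)\<^sup>2 = u * v" by (simp add: u_def v_def power2_eq_square algebra_simps)
  have pos: "u > 0" "v > 0" "1 - t > 0" "1 + a > 0" using a at t add_pos_nonneg[OF zero_less_one at(1)] by (auto simp: u_def v_def)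
  have fac: "1 / (1 + a) + t / (1 - t) = v / ((1 + a) * (1 - t))"
    using pos by (simp add: v_def divide_simps) (simp add: algebra_simps)
  have "(1 - a\<^sup>2) * t * (1 / u) + (1 / (1 + a) + t / (1 - t)) * (((1 - a\<^sup>2) * t)\<^sup>2 * (1 / (u * v)))
      = (1 - a\<^sup>2) * t / u * (1 + (1 - a\<^sup>2) * t / ((1 + a) * (1 - t)))"
    unfolding fac using pos by (simp add: divide_simps) (simp add: algebra_simps power2_eq_square)
  also have "(1 - a\<^sup>2) * t / ((1 + a) * (1 - t)) = (1 - a) * t / (1 - t)"
    using pos by (simp add: divide_simps) (simp add: algebra_simps power2_eq_square)
  also have "1 + (1 - a) * t / (1 - t) = u / (1 - t)"
    using pos by (simp add: u_def divide_simps) (simp add: algebra_simps)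
  also have "(1 - a\<^sup>2) * t / u * (u / (1 - t)) = (1 - a\<^sup>2) * (t / (1 - t))"
    using pos by simp
  finally have eq: "(1 - a\<^sup>2) * t * (1 / u) + (1 / (1 + a) + t / (1 - t)) * (((1 - a\<^sup>2) * t)\<^sup>2 * (1 / (u * v)))
      = (1 - a\<^sup>2) * (t / (1 - t))" .
  have "bohr_sum p c t f P z = a powr p + (1 - a\<^sup>2) * t * (1 / u)
      + (c + t / (1 - t)) * (((1 - a\<^sup>2) * t)\<^sup>2 * (1 / (u * v)))"
    unfolding bohr_sum_def f0 sums_unique[OF s1, symmetric] sums_unique[OF s2, symmetric] uv u_def ..
  also have "\<dots> = a powr p + (1 - a\<^sup>2) * (t / (1 - t))
           + (c - 1 / (1 + a)) * (((1 - a\<^sup>2) * t)\<^sup>2 * (1 / (u * v)))"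
  proof -
    have "A + (\<alpha> + \<tau>) * X = B \<Longrightarrow> C + A + (c + \<tau>) * X = C + B + (c - \<alpha>) * X"
      for A B C X \<alpha> \<tau> :: real by (simp add: algebra_simps)
    from this[OF eq] show ?thesis .
  qed
  finally show "bohr_sum p c t f P z = a powr p + (1 - a\<^sup>2) * (t / (1 - t))
           + (c - 1 / (1 + a)) * ((1 - a\<^sup>2)\<^sup>2 * t\<^sup>2 / (1 - a\<^sup>2 * t\<^sup>2))"
    by (simp add: uv[symmetric] power_mult_distrib)
qed

text \<open>The disc automorphism composed with the extremal functional. Since \<open>Q\<close> is open the functional does
  not attain modulus \<open>\<rho>\<close> on \<open>\<rho> Q\<close>, so the value of the sum is only available for \<open>t < \<rho>\<close>.\<close>

lemma extremal_function_on_convex_domain: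
  fixes Q :: "(complex ^ 'n) set"
  assumes Q: "complete_circular_domain Q" "convex Q" "Q \<noteq> UNIV"
    and a: "0 \<le> a" "a < 1"
  obtains f P where "holomorphic_Cn_on f Q" "homogeneous_expansion_on f P Q"
    "\<forall>w\<in>Q. cmod (f w) < 1" "cmod (f 0) = a"
    "\<And>\<rho> t p c. 0 \<le> t \<Longrightarrow> t < \<rho> \<Longrightarrow> \<rho> \<le> 1 \<Longrightarrow> \<exists>z \<in> homothetic \<rho> Q. bohr_summable P z \<and>
       bohr_sum p c t f P z = a powr p + (1 - a\<^sup>2) * (t / (1 - t))
           + (c - 1 / (1 + a)) * ((1 - a\<^sup>2)\<^sup>2 * t\<^sup>2 / (1 - a\<^sup>2 * t\<^sup>2))"
proof -
  obtain l where l1: "\<And>z. z \<in> Q \<Longrightarrow> cmod (\<Sum>i\<in>UNIV. l i * z $ i) < 1"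
    and l2: "\<And>t. 0 \<le> t \<Longrightarrow> t < 1 \<Longrightarrow> \<exists>z\<in>Q. (\<Sum>i\<in>UNIV. l i * z $ i) = complex_of_real t"
    using extremal_linear_functional[OF Q] by blast
  define L where "L z = (\<Sum>i\<in>UNIV. l i * z $ i)" for z :: "complex ^ 'n"
  define f where "f z = (of_real a - L z) / (1 - of_real a * L z)" for z
  define P where "P k = (\<lambda>z. mobius_coeff a k * L z ^ k)" for k
  have f0: "cmod (f 0) = a" using a by (simp add: f_def L_def)
  show ?thesis
  proof (rule that[of f P])
    show "holomorphic_Cn_on f Q"
      unfolding f_def L_def by (rule holomorphic_mobius_linear[OF a l1])
    show "homogeneous_expansion_on f P Q"
      unfolding homogeneous_expansion_on_def
    proof (intro conjI allI ballI)
      show "homogeneous_polynomial k (P k)" for k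
        using homogeneous_polynomial_linear_power[of k "mobius_coeff a k" l]
        by (simp add: P_def L_def)
      show "(\<lambda>k. P k z) sums f z" if "z \<in> Q" for z
        using mobius_coeff_sums[OF a l1[OF that]] by (simp add: f_def P_def L_def)
    qed
    show "\<forall>w\<in>Q. cmod (f w) < 1"
      using mobius_norm_less_1[OF a l1] by (auto simp: f_def L_def)
    show "cmod (f 0) = a" by (fact f0)
    fix \<rho> t p c :: real
    assume t: "0 \<le> t" "t < \<rho>" and \<rho>: "\<rho> \<le> 1"
    obtain z where z: "z \<in> Q" "L z = of_real (t / \<rho>)"
      using l2[of "t / \<rho>"] t unfolding L_def by auto
    have "L (\<rho> *\<^sub>R z) = of_real \<rho> * L z"
      by (simp add: L_def scaleR_eq_vector_smult sum_distrib_left mult_ac)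
    then have "L (\<rho> *\<^sub>R z) = of_real t" using z t by simp
    then have "P k (\<rho> *\<^sub>R z) = mobius_coeff a k * of_real t ^ k" for k by (simp add: P_def)
    from bohr_sum_extremal[where f = f and P = P, OF a t(1) _ f0 this] t \<rho>
    show "\<exists>z \<in> homothetic \<rho> Q. bohr_summable P z \<and>
       bohr_sum p c t f P z = a powr p + (1 - a\<^sup>2) * (t / (1 - t))
           + (c - 1 / (1 + a)) * ((1 - a\<^sup>2)\<^sup>2 * t\<^sup>2 / (1 - a\<^sup>2 * t\<^sup>2))"
      using z(1) unfolding homothetic_def by (intro bexI[of _ "\<rho> *\<^sub>R z"]) auto
  qed
qed

section \<open>The Bohr inequality and its sharpness\<close>

theorem theorem1:
  fixes Q :: "(complex ^ 'n) set" and p :: real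
  assumes Q: "complete_circular_domain Q"
    and p: "0 < p" "p \<le> 2"
  shows "(\<forall>f P. holomorphic_Cn_on f Q \<longrightarrow> homogeneous_expansion_on f P Q
            \<longrightarrow> (\<forall>z\<in>Q. cmod (f z) < 1)
            \<longrightarrow> (\<forall>z\<in>homothetic (bohr_radius p (cmod (f 0))) Q.
                  \<forall>r. 0 \<le> r \<and> r \<le> bohr_radius p (cmod (f 0)) \<longrightarrow>
                    bohr_summable P z \<and> bohr_sum p (1 / (1 + cmod (f 0))) r f P z \<le> 1))
       \<and> (convex Q \<and> Q \<noteq> UNIV \<longrightarrow>
            (\<forall>a. 0 \<le> a \<and> a < 1 \<longrightarrow>
              (\<forall>\<rho>. bohr_radius p a < \<rho> \<and> \<rho> \<le> 1 \<longrightarrow>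
                (\<exists>f P z r. holomorphic_Cn_on f Q \<and> homogeneous_expansion_on f P Q
                   \<and> (\<forall>w\<in>Q. cmod (f w) < 1) \<and> cmod (f 0) = a
                   \<and> z \<in> homothetic \<rho> Q \<and> 0 \<le> r \<and> r \<le> \<rho> \<and> r < 1
                   \<and> bohr_summable P z \<and> 1 < bohr_sum p (1 / (1 + a)) r f P z))
            \<and> (\<forall>c. 1 / (1 + a) < c \<longrightarrow>
                (\<exists>f P z r. holomorphic_Cn_on f Q \<and> homogeneous_expansion_on f P Q
                   \<and> (\<forall>w\<in>Q. cmod (f w) < 1) \<and> cmod (f 0) = a
                   \<and> z \<in> homothetic (bohr_radius p a) Q \<and> 0 \<le> r \<and> r \<le> bohr_radius p a
                   \<and> bohr_summable P z \<and> 1 < bohr_sum p c r f P z))))"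
proof (intro conjI allI impI ballI; (elim conjE)?)
  fix f P z r
  assume "homogeneous_expansion_on f P Q" "\<forall>z\<in>Q. cmod (f z) < 1"
    "z \<in> homothetic (bohr_radius p (cmod (f 0))) Q" "0 \<le> r" "r \<le> bohr_radius p (cmod (f 0))"
  note bohr = bohr_inequality_circular_domain[OF Q p(1) this]
  then show "bohr_summable P z" "bohr_sum p (1 / (1 + cmod (f 0))) r f P z \<le> 1" by auto
next
  fix a \<rho> :: real
  assume cvx: "convex Q" "Q \<noteq> UNIV" and a: "0 \<le> a" "a < 1"
    and \<rho>: "bohr_radius p a < \<rho>" "\<rho> \<le> 1"
  obtain f P where f: "holomorphic_Cn_on f Q" "homogeneous_expansion_on f P Q"
    "\<forall>w\<in>Q. cmod (f w) < 1" "cmod (f 0) = a"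
    "\<And>\<rho> t p c. 0 \<le> t \<Longrightarrow> t < \<rho> \<Longrightarrow> \<rho> \<le> 1 \<Longrightarrow> \<exists>z \<in> homothetic \<rho> Q. bohr_summable P z \<and>
       bohr_sum p c t f P z = a powr p + (1 - a\<^sup>2) * (t / (1 - t))
           + (c - 1 / (1 + a)) * ((1 - a\<^sup>2)\<^sup>2 * t\<^sup>2 / (1 - a\<^sup>2 * t\<^sup>2))"
    using extremal_function_on_convex_domain[OF Q cvx a] by blast
  \<comment> \<open>at any \<open>t\<close> strictly between the two radii, with \<open>r = t\<close>, the extremal sum already exceeds 1\<close>
  obtain t where t: "bohr_radius p a < t" "t < \<rho>" using dense[OF \<rho>(1)] by blast
  have t0: "0 \<le> t" using t bohr_radius_bounds(3)[OF p(1) a] by linarith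
  have t1: "t < 1" using t \<rho> by linarith
  obtain z where z: "z \<in> homothetic \<rho> Q" "bohr_summable P z"
      "bohr_sum p (1 / (1 + a)) t f P z = a powr p + (1 - a\<^sup>2) * (t / (1 - t))"
    using f(5)[OF t0 t(2) \<rho>(2), of p "1 / (1 + a)"] by auto
  have "1 < a powr p + (1 - a\<^sup>2) * (t / (1 - t))"
    using bohr_radius_iff[OF p(1) a t1] t(1) by linarith
  with f(1-4) z t t0 t1
  show "\<exists>f P z r. holomorphic_Cn_on f Q \<and> homogeneous_expansion_on f P Q
                   \<and> (\<forall>w\<in>Q. cmod (f w) < 1) \<and> cmod (f 0) = a
                   \<and> z \<in> homothetic \<rho> Q \<and> 0 \<le> r \<and> r \<le> \<rho> \<and> r < 1
                   \<and> bohr_summable P z \<and> 1 < bohr_sum p (1 / (1 + a)) r f P z"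
    by (intro exI[of _ f] exI[of _ P] exI[of _ z] exI[of _ t]) simp
next
  fix a c :: real
  assume cvx: "convex Q" "Q \<noteq> UNIV" and a: "0 \<le> a" "a < 1" and c: "1 / (1 + a) < c"
  obtain f P where f: "holomorphic_Cn_on f Q" "homogeneous_expansion_on f P Q"
    "\<forall>w\<in>Q. cmod (f w) < 1" "cmod (f 0) = a"
    "\<And>\<rho> t p c. 0 \<le> t \<Longrightarrow> t < \<rho> \<Longrightarrow> \<rho> \<le> 1 \<Longrightarrow> \<exists>z \<in> homothetic \<rho> Q. bohr_summable P z \<and>
       bohr_sum p c t f P z = a powr p + (1 - a\<^sup>2) * (t / (1 - t))
           + (c - 1 / (1 + a)) * ((1 - a\<^sup>2)\<^sup>2 * t\<^sup>2 / (1 - a\<^sup>2 * t\<^sup>2))"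
    using extremal_function_on_convex_domain[OF Q cvx a] by blast
  define R where "R = bohr_radius p a"
  have R: "0 < R" "R < 1" using bohr_radius_bounds[OF p(1) a] by (auto simp: R_def)
  have a2: "a\<^sup>2 < 1" using bohr_radius_bounds[OF p(1) a] by simp
  \<comment> \<open>the extremal sum with \<open>r = t\<close>; it exceeds 1 at \<open>t = R\<close>, hence also at some \<open>t < R\<close>, which is
    the value of the functional at a point of \<open>R Q\<close>\<close>
  define g where "g t = a powr p + (1 - a\<^sup>2) * (t / (1 - t))
           + (c - 1 / (1 + a)) * ((1 - a\<^sup>2)\<^sup>2 * t\<^sup>2 / (1 - a\<^sup>2 * t\<^sup>2))" for t
  have "R\<^sup>2 < 1" using R by (simp add: abs_square_less_1)
  then have d: "1 - a\<^sup>2 * R\<^sup>2 > 0"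
    using mult_strict_mono'[of "a\<^sup>2" 1 "R\<^sup>2" 1] a2 by simp
  have "1 = a powr p + (1 - a\<^sup>2) * (R / (1 - R))"
  proof -
    define D where "D = 2 - a\<^sup>2 - a powr p"
    have D: "D > 0" using a2 bohr_radius_bounds(2)[OF p(1) a] by (simp add: D_def)
    have "R = (1 - a powr p) / D" by (simp add: R_def bohr_radius_def D_def)
    moreover from this have "1 - R = (1 - a\<^sup>2) / D" using D by (simp add: D_def field_simps)
    ultimately show ?thesis using D a2 by simp
  qed
  moreover have "(c - 1 / (1 + a)) * ((1 - a\<^sup>2)\<^sup>2 * R\<^sup>2 / (1 - a\<^sup>2 * R\<^sup>2)) > 0"
    using c R d a2 by (intro mult_pos_pos divide_pos_pos) auto
  ultimately have gR: "g R > 1" unfolding g_def by linarith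
  have "(g \<longlongrightarrow> g R) (at_left R)"
    unfolding g_def using R d by (intro tendsto_intros) auto
  then have "eventually (\<lambda>t. g t > 1) (at_left R)"
    using gR by (rule order_tendstoD)
  moreover have "eventually (\<lambda>t. t \<in> {0<..<R}) (at_left R)"
    using R by (intro eventually_at_left_real)
  ultimately have "eventually (\<lambda>t. g t > 1 \<and> t \<in> {0<..<R}) (at_left R)"
    by (rule eventually_conj)
  then have "\<exists>t. g t > 1 \<and> t \<in> {0<..<R}"
    by (rule eventually_happens'[rotated]) simp
  then obtain t where t: "g t > 1" "0 \<le> t" "t < R" by auto
  obtain z where "z \<in> homothetic R Q" "bohr_summable P z" "bohr_sum p c t f P z = g t"
    using f(5)[OF t(2,3), of p c] R unfolding g_def by auto
  with f(1-4) t
  show "\<exists>f P z r. holomorphic_Cn_on f Q \<and> homogeneous_expansion_on f P Q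
                   \<and> (\<forall>w\<in>Q. cmod (f w) < 1) \<and> cmod (f 0) = a
                   \<and> z \<in> homothetic (bohr_radius p a) Q \<and> 0 \<le> r \<and> r \<le> bohr_radius p a
                   \<and> bohr_summable P z \<and> 1 < bohr_sum p c r f P z"
    unfolding R_def[symmetric]
    by (intro exI[of _ f] exI[of _ P] exI[of _ z] exI[of _ t]) simp
qed

end
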